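(* For every $i\ge 2$, $\lambda(T_i)=3$.
   Context: A formula is a finite set of non-empty words over variables (fragments), written separated by dots. An occurrence of a formula $f$ in a word $w$ over an alphabet $\Sigma$ is a non-erasing morphism $h$ from variables to non-empty words over $\Sigma$ such that $h(\phi)$ is a factor of $w$ for every fragment $\phi$; $\lambda(f)$ is the smallest size of an alphabet over which there exists an infinite word containing no occurrence of $f$. For $i\ge1$, $T_i$ is the formula on variables $A_0,\dots,A_{i-1}$ whose fragments are the $i$ words $A_jA_{j+1}A_j$, $0\le j\le i-1$, indices modulo $i$ (so $T_1=AAA$, $T_2=ABA.BAB$, $T_3=ABA.BCB.CAC$, etc.). *)

theory Defs
  imports "HOL-Library.Extended_Nat"
begin

type_synonym 'v formula = "'v list set"

definition is_formula :: "'v formula \<Rightarrow> bool" where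
  "is_formula f \<longleftrightarrow> finite f \<and> [] \<notin> f"

definition infinite_word_over :: "'a set \<Rightarrow> (nat \<Rightarrow> 'a) \<Rightarrow> bool" where
  "infinite_word_over \<Sigma> w \<longleftrightarrow> range w \<subseteq> \<Sigma>"

definition factor_of :: "'a list \<Rightarrow> (nat \<Rightarrow> 'a) \<Rightarrow> bool" where
  "factor_of u w \<longleftrightarrow> (\<exists>k. u = map w [k..<k + length u])"

text \<open>A morphism is determined by the images of the variables; its value on a word is the
  concatenation of the images of the letters.\<close>

definition morph :: "('v \<Rightarrow> 'a list) \<Rightarrow> 'v list \<Rightarrow> 'a list" where
  "morph h \<phi> = concat (map h \<phi>)"

definition occurrence :: "'a set \<Rightarrow> 'v formula \<Rightarrow> (nat \<Rightarrow> 'a) \<Rightarrow> ('v \<Rightarrow> 'a list) \<Rightarrow> bool" where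
  "occurrence \<Sigma> f w h \<longleftrightarrow>
     (\<forall>x. h x \<in> lists \<Sigma> \<and> h x \<noteq> []) \<and> (\<forall>\<phi>\<in>f. factor_of (morph h \<phi>) w)"

definition avoidable_over :: "'a set \<Rightarrow> 'v formula \<Rightarrow> bool" where
  "avoidable_over \<Sigma> f \<longleftrightarrow> (\<exists>w. infinite_word_over \<Sigma> w \<and> (\<nexists>h. occurrence \<Sigma> f w h))"

text \<open>The value is \<open>\<infinity>\<close> if the formula is unavoidable over every finite alphabet. Taking the
  letters to be natural numbers is no restriction, since every finite alphabet embeds into them.\<close>

definition avoidability_index :: "'v formula \<Rightarrow> enat" where
  "avoidability_index f =
     Inf {enat (card \<Sigma>) | \<Sigma> :: nat set. finite \<Sigma> \<and> avoidable_over \<Sigma> f}"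

text \<open>The variable \<open>A\<^sub>j\<close> is represented by the number \<open>j\<close>.\<close>

definition T :: "nat \<Rightarrow> nat formula" where
  "T i = (\<lambda>j. [j, (j + 1) mod i, j]) ` {..<i}"

lemma is_formula_T: "is_formula (T i)"
  by (auto simp: is_formula_def T_def)

lemma T_1: "T 1 = {[0,0,0]}"
  by (auto simp: T_def)

lemma T_2: "T 2 = {[0,1,0], [1,0,1]}"
proof -
  have "{..<2::nat} = {0,1}" by auto
  then show ?thesis by (simp add: T_def)
qed

lemma T_3: "T 3 = {[0,1,0], [1,2,1], [2,0,2]}"
proof -
  have "{..<3::nat} = {0,1,2}" by auto
  then show ?thesis by (simp add: T_def numeral_2_eq_2)
qed

end

theory Submission
  imports Defs "HOL-Library.Sublist"
begin

text \<open>Write \<open>u \<rightarrow> v\<close> if \<open>uvu\<close> is a factor of the word \<open>w\<close>; an occurrence of \<open>T\<^sub>i\<close> in \<open>w\<close> is a closed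
  walk of length \<open>i\<close>. Every binary word of length 22 contains a cube or, more generally, some \<open>u\<close> that
  lies on closed walks of lengths 2 and 3, hence on closed walks of every length \<open>i \<ge> 2\<close>.

  For the upper bound, a six-letter word without repetitions of exponent at least 3/2 is mapped by a
  25-uniform morphism to a ternary word in which the only factors \<open>uvu\<close> with \<open>|u| \<ge> |v|\<close> are 020,
  101 and 121. So along an edge either the length increases, or both ends are single letters and
  the letter moves up in the order 1, 0, 2; closed walks are therefore impossible.

  In both uniform images a repetition of exponent at least 3/2 with long period has, by
  synchronization, a period divisible by the block length. It then descends to a repetition of
  exponent at least 3/2 in the preimage. Short periods are checked by computation.\<close>

section \<open>Repetitions in uniform images\<close>

text \<open>A factor of length \<open>p + r\<close> with period \<open>p\<close>. For
  \<open>p > 0\<close> its exponent is at least 3/2 exactly when \<open>p \<le> 2 * r\<close>, the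
  form in which exponents are bounded below.\<close>

definition repeats :: "(nat \<Rightarrow> 'a) \<Rightarrow> nat \<Rightarrow> nat \<Rightarrow> nat \<Rightarrow> bool" where
  "repeats z n p r \<longleftrightarrow> (\<forall>t<r. z (n + t) = z (n + p + t))"

lemma repeats_mono: "repeats z n p r \<Longrightarrow> r' \<le> r \<Longrightarrow> repeats z n p r'"
  by (auto simp: repeats_def)

section \<open>Executable search for repetitions in a list\<close>

fun agree :: "nat \<Rightarrow> 'a list \<Rightarrow> 'a list \<Rightarrow> bool" where
  "agree 0 xs ys = True"
| "agree (Suc r) (x # xs) (y # ys) = (x = y \<and> agree r xs ys)"
| "agree (Suc r) _ _ = False"

text \<open>\<open>agree\<close> is false on lists that are too short, so refuting it excludes a
  repetition only together with these length bounds.\<close>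

lemma agreeI:
  "r \<le> length xs \<Longrightarrow> r \<le> length ys \<Longrightarrow> (\<And>t. t < r \<Longrightarrow> xs ! t = ys ! t) \<Longrightarrow> agree r xs ys"
proof (induction r xs ys rule: agree.induct)
  case (2 r x xs y ys)
  have "x = y" using "2.prems"(3)[of 0] by simp
  moreover have "xs ! t = ys ! t" if "t < r" for t
    using "2.prems"(3)[of "Suc t"] that by simp
  ultimately show ?case using 2 by simp
qed auto

text \<open>The checks below are evaluated by \<open>code_simp\<close>, which also rewrites under abstractions;
  therefore they are written as first-order recursions.\<close>

fun no_agreement :: "nat list \<Rightarrow> 'a list \<Rightarrow> 'a list \<Rightarrow> bool" where
  "no_agreement (r # rs) ys (z # zs) = (\<not> agree r ys (z # zs) \<and> no_agreement rs ys zs)"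
| "no_agreement [] ys zs = True"
| "no_agreement (r # rs) ys [] = False"

lemma no_agreementD:
  "no_agreement rs ys zs \<Longrightarrow> k < length rs \<Longrightarrow> \<not> agree (rs ! k) ys (drop k zs)"
proof (induction rs ys zs arbitrary: k rule: no_agreement.induct)
  case (1 r rs ys z zs)
  then show ?case by (cases k) auto
qed auto

text \<open>Entry \<open>k\<close> of \<open>rs\<close> is the overlap tested for period
  \<open>p + k + 1\<close>; the extra one arises because \<open>drop p\<close> acts on the
  tail.\<close>

fun no_repeats :: "nat \<Rightarrow> nat list \<Rightarrow> nat \<Rightarrow> 'a list \<Rightarrow> bool" where
  "no_repeats 0 rs p xs = True"
| "no_repeats (Suc q) rs p (x # xs) =
     (no_agreement rs (x # xs) (drop p xs) \<and> no_repeats q rs p xs)"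
| "no_repeats (Suc q) rs p [] = False"

lemma no_repeatsD:
  "no_repeats q rs p xs \<Longrightarrow> s < q \<Longrightarrow> k < length rs \<Longrightarrow>
     \<not> agree (rs ! k) (drop s xs) (drop (Suc (s + p + k)) xs)"
proof (induction q rs p xs arbitrary: s rule: no_repeats.induct)
  case (2 q rs p x xs)
  show ?case
  proof (cases s)
    case 0
    have "\<not> agree (rs ! k) (x # xs) (drop k (drop p xs))"
      using 2 by (intro no_agreementD) auto
    then show ?thesis by (simp add: 0 add.commute)
  next
    case (Suc s')
    have "\<not> agree (rs ! k) (drop s' xs) (drop (Suc (s' + p + k)) xs)"
      using 2 Suc by auto
    then show ?thesis by (simp add: Suc)
  qed
qed auto

fun all_no_repeats :: "nat \<Rightarrow> nat list \<Rightarrow> nat \<Rightarrow> 'a list list \<Rightarrow> bool" where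
  "all_no_repeats q rs p [] = True"
| "all_no_repeats q rs p (xs # xss) = (no_repeats q rs p xs \<and> all_no_repeats q rs p xss)"

lemma all_no_repeatsD: "all_no_repeats q rs p xss \<Longrightarrow> xs \<in> set xss \<Longrightarrow> no_repeats q rs p xs"
  by (induction xss) auto

section \<open>Synchronization check\<close>

fun same_index :: "('a list \<times> nat) list \<Rightarrow> bool" where
  "same_index ((u, i) # (v, j) # ws) = (i = j \<and> same_index ((v, j) # ws))"
| "same_index _ = True"

lemma same_indexD:
  "same_index ws \<Longrightarrow> (u, i) \<in> set ws \<Longrightarrow> (v, j) \<in> set ws \<Longrightarrow> i = j"
proof -
  \<comment> \<open>Only neighbours are compared, so all indices are traced back to the one at the
    head.\<close>
  have "i = snd (hd ws)" if "same_index ws" "(u, i) \<in> set ws" for ws u i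
    using that by (induction ws rule: same_index.induct) auto
  then show "same_index ws \<Longrightarrow> (u, i) \<in> set ws \<Longrightarrow> (v, j) \<in> set ws \<Longrightarrow> i = j" by metis
qed

fun subtrie :: "'a \<Rightarrow> ('a list \<times> nat) list \<Rightarrow> ('a list \<times> nat) list" where
  "subtrie c [] = []"
| "subtrie c ((x # u, i) # ws) = (if x = c then (u, i) # subtrie c ws else subtrie c ws)"
| "subtrie c (([], i) # ws) = subtrie c ws"

lemma subtrieI: "(c # u, i) \<in> set ws \<Longrightarrow> (u, i) \<in> set (subtrie c ws)"
  by (induction c ws rule: subtrie.induct) auto

text \<open>The words are read like a trie, so that they need not be compared in pairs; the third argument
  lists the letters whose branches are still to be visited.\<close>

fun synchronized :: "'a list \<Rightarrow> nat \<Rightarrow> 'a list \<Rightarrow> ('a list \<times> nat) list \<Rightarrow> bool" where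
  "synchronized A 0 cs ws = same_index ws"
| "synchronized A (Suc r) [] ws = True"
| "synchronized A (Suc r) (c # cs) ws =
     (synchronized A r A (subtrie c ws) \<and> synchronized A (Suc r) cs ws)"

text \<open>Both words follow the same branch of the trie for \<open>r\<close> letters and reach the
  same leaf, where all indices coincide. The assumption on \<open>hd u\<close> says that this branch
  is still to be visited.\<close>

lemma synchronizedD:
  assumes "synchronized A r cs ws" "(u, i) \<in> set ws" "(v, j) \<in> set ws"
    and "r \<le> length u" "r \<le> length v" "set u \<subseteq> set A" "0 < r \<Longrightarrow> hd u \<in> set cs"
    and "\<And>t. t < r \<Longrightarrow> u ! t = v ! t"
  shows "i = j"
  using assms
proof (induction A r cs ws arbitrary: u v rule: synchronized.induct)
  case (1 A cs ws)
  then show ?case using same_indexD by auto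
next
  case (2 A r ws)
  then show ?case by simp
next
  case (3 A r c cs ws)
  show ?case
  proof (cases "hd u = c")
    case True
    obtain u' where u: "u = c # u'" using True "3.prems"(4) by (cases u) auto
    obtain v' where v: "v = c # v'"
      using "3.prems"(5) "3.prems"(8)[of 0] u by (cases v) auto
    show ?thesis
    proof (rule "3.IH"(1))
      show "synchronized A r A (subtrie c ws)" using "3.prems"(1) by simp
      show "(u', i) \<in> set (subtrie c ws)" "(v', j) \<in> set (subtrie c ws)"
        using "3.prems"(2,3) u v by (auto intro: subtrieI)
      show "r \<le> length u'" "r \<le> length v'" "set u' \<subseteq> set A"
        using "3.prems"(4-6) u v by auto
      then show "hd u' \<in> set A" if "0 < r"
        using that by (cases u') auto
      show "u' ! t = v' ! t" if "t < r" for t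
        using "3.prems"(8)[of "Suc t"] that by (simp add: u v)
    qed
  next
    case False
    show ?thesis
      by (rule "3.IH"(2)[of u v]) (use "3.prems" False in auto)
  qed
qed

fun add_windows :: "nat \<Rightarrow> nat \<Rightarrow> nat \<Rightarrow> 'a list \<Rightarrow> ('a list \<times> nat) list \<Rightarrow> ('a list \<times> nat) list" where
  "add_windows r 0 i xs ws = ws"
| "add_windows r (Suc q) i (x # xs) ws = (take r (x # xs), i) # add_windows r q (Suc i) xs ws"
| "add_windows r (Suc q) i [] ws = ws"

lemma add_windows_mono: "set ws \<subseteq> set (add_windows r q i xs ws)"
  by (induction r q i xs ws rule: add_windows.induct) auto

lemma add_windowsI:
  "s < q \<Longrightarrow> s < length xs \<Longrightarrow> (take r (drop s xs), i + s) \<in> set (add_windows r q i xs ws)"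
proof (induction r q i xs ws arbitrary: s rule: add_windows.induct)
  case (2 r q i x xs ws)
  then show ?case
  proof (cases s)
    case (Suc s')
    then have "(take r (drop s' xs), Suc i + s') \<in> set (add_windows r q (Suc i) xs ws)"
      using "2.prems" by (intro "2.IH") auto
    then show ?thesis using Suc by simp
  qed simp
qed auto

fun windows :: "nat \<Rightarrow> nat \<Rightarrow> 'a list list \<Rightarrow> ('a list \<times> nat) list" where
  "windows r q [] = []"
| "windows r q (xs # xss) = add_windows r q 0 xs (windows r q xss)"

lemma windowsI:
  "xs \<in> set xss \<Longrightarrow> s < q \<Longrightarrow> s < length xs \<Longrightarrow> (take r (drop s xs), s) \<in> set (windows r q xss)"
proof (induction xss)
  case (Cons ys xss)
  then show ?case
    using add_windowsI[of s q ys r 0] add_windows_mono by (cases "xs = ys") fastforce+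
qed simp

section \<open>Windows of three letters\<close>

fun all_windows3 :: "('a \<Rightarrow> 'a \<Rightarrow> 'a \<Rightarrow> bool) \<Rightarrow> nat \<Rightarrow> 'a list \<Rightarrow> bool" where
  "all_windows3 P 0 xs = True"
| "all_windows3 P (Suc q) (a # b # c # xs) = (P a b c \<and> all_windows3 P q (b # c # xs))"
| "all_windows3 P (Suc q) _ = False"

lemma all_windows3D:
  "all_windows3 P q xs \<Longrightarrow> s < q \<Longrightarrow> P (xs ! s) (xs ! (s + 1)) (xs ! (s + 2))"
proof (induction P q xs arbitrary: s rule: all_windows3.induct)
  case (2 P q a b c xs)
  then show ?case by (cases s) auto
qed auto

fun all_all_windows3 :: "('a \<Rightarrow> 'a \<Rightarrow> 'a \<Rightarrow> bool) \<Rightarrow> nat \<Rightarrow> 'a list list \<Rightarrow> bool" where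
  "all_all_windows3 P q [] = True"
| "all_all_windows3 P q (xs # xss) = (all_windows3 P q xs \<and> all_all_windows3 P q xss)"

lemma all_all_windows3D: "all_all_windows3 P q xss \<Longrightarrow> xs \<in> set xss \<Longrightarrow> all_windows3 P q xs"
  by (induction xss) auto

text \<open>The length is prescribed only on letters of \<open>y\<close>, since
  \<open>(!) blocks\<close> is unspecified beyond its range.\<close>

locale uniform_image =
  fixes g :: "'b \<Rightarrow> 'a list" and q :: nat and y :: "nat \<Rightarrow> 'b" and z :: "nat \<Rightarrow> 'a"
  assumes pos: "0 < q"
    and length_block: "\<And>n. length (g (y n)) = q"
    and image: "\<And>n. z n = g (y (n div q)) ! (n mod q)"
begin

lemma block_nth: "k < q \<Longrightarrow> z (q * m + k) = g (y m) ! k"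
  using pos by (simp add: image)

lemma nth_two_blocks:
  assumes "k < 2 * q"
  shows "z (q * m + k) = (g (y m) @ g (y (m + 1))) ! k"
proof (cases "k < q")
  case True
  then show ?thesis using length_block by (simp add: nth_append block_nth)
next
  case False
  then have "z (q * m + k) = z (q * (m + 1) + (k - q))" by (simp add: algebra_simps)
  also have "\<dots> = g (y (m + 1)) ! (k - q)" using False assms by (intro block_nth) simp
  finally show ?thesis using False length_block by (simp add: nth_append)
qed

lemma nth_three_blocks:
  assumes "k < 3 * q"
  shows "z (q * m + k) = (g (y m) @ g (y (m + 1)) @ g (y (m + 2))) ! k"
proof (cases "k < q")
  case True
  then show ?thesis using length_block by (simp add: nth_append block_nth)
next
  case False
  then have "z (q * m + k) = z (q * (m + 1) + (k - q))" by (simp add: algebra_simps)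
  also have "\<dots> = (g (y (m + 1)) @ g (y (m + 2))) ! (k - q)"
    using nth_two_blocks[of "k - q" "m + 1"] False assms by simp
  finally show ?thesis using False length_block by (simp add: nth_append)
qed

text \<open>The start modulo \<open>q\<close> is at most \<open>q - 1\<close>, so the bound
  \<open>small\<close> keeps both copies of the overlap inside three consecutive blocks, where the
  list check applies.\<close>

lemma not_repeats:
  assumes check: "all_no_repeats q rs p xss"
    and mem: "\<And>m. g (y m) @ g (y (m + 1)) @ g (y (m + 2)) \<in> set xss"
    and k: "k < length rs" and small: "p + k + rs ! k \<le> 2 * q"
  shows "\<not> repeats z n (Suc (p + k)) (rs ! k)"
proof
  assume rep: "repeats z n (Suc (p + k)) (rs ! k)"
  define s where "s = n mod q"
  define xs where "xs = g (y (n div q)) @ g (y (n div q + 1)) @ g (y (n div q + 2))"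
  have s: "s < q" using pos by (simp add: s_def)
  have len: "length xs = 3 * q" by (simp add: xs_def length_block)
  have nth: "z (n + t) = xs ! (s + t)" if "s + t < 3 * q" for t
  proof -
    have "z (n + t) = z (q * (n div q) + (s + t))" by (simp add: s_def add.assoc [symmetric])
    then show ?thesis using nth_three_blocks that by (simp add: xs_def)
  qed
  have "no_repeats q rs p xs"
    using all_no_repeatsD[OF check mem] by (simp add: xs_def)
  then have "\<not> agree (rs ! k) (drop s xs) (drop (Suc (s + p + k)) xs)"
    using s k by (rule no_repeatsD)
  moreover have "agree (rs ! k) (drop s xs) (drop (Suc (s + p + k)) xs)"
  proof (rule agreeI)
    show "rs ! k \<le> length (drop s xs)" "rs ! k \<le> length (drop (Suc (s + p + k)) xs)"
      using s small by (auto simp: len)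
  next
    fix t assume t: "t < rs ! k"
    have "xs ! (s + t) = z (n + t)" using s small t by (simp add: nth)
    also have "\<dots> = z (n + (Suc (p + k) + t))" using rep t by (simp add: repeats_def add.assoc)
    also have "\<dots> = xs ! (s + (Suc (p + k) + t))" using s small t by (intro nth) simp
    finally show "drop s xs ! t = drop (Suc (s + p + k)) xs ! t"
      using s small t by (simp add: len add.assoc)
  qed
  ultimately show False by contradiction
qed

text \<open>The windows of length \<open>r\<close> at \<open>n\<close> and \<open>n + p\<close> are
  equal, and by the check equal windows have the same position modulo \<open>q\<close>.\<close>

lemma dvd_period:
  assumes check: "synchronized A r A (windows r q xss)"
    and mem: "\<And>m. g (y m) @ g (y (m + 1)) \<in> set xss"
    and alphabet: "\<And>n. set (g (y n)) \<subseteq> set A"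
    and small: "r \<le> q" and rep: "repeats z n p r"
  shows "q dvd p"
proof -
  define win where "win m = take r (drop (m mod q) (g (y (m div q)) @ g (y (m div q + 1))))" for m
  have lt: "m mod q < q" for m using pos by simp
  have len: "length (win m) = r" for m
    using lt[of m] small by (simp add: win_def length_block)
  have win_mem: "(win m, m mod q) \<in> set (windows r q xss)" for m
    unfolding win_def using mem lt[of m] by (intro windowsI) (auto simp: length_block)
  have sub: "set (win m) \<subseteq> set A" for m
  proof -
    have "set (win m) \<subseteq> set (g (y (m div q)) @ g (y (m div q + 1)))"
      unfolding win_def by (meson in_set_dropD in_set_takeD subsetI)
    then show ?thesis using alphabet by fastforce
  qed
  have nth: "win m ! t = z (m + t)" if "t < r" for m t
  proof -
    have "z (m + t) = z (q * (m div q) + (m mod q + t))" by (simp add: add.assoc [symmetric])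
    also have "\<dots> = (g (y (m div q)) @ g (y (m div q + 1))) ! (m mod q + t)"
      by (intro nth_two_blocks) (use that small lt[of m] in linarith)
    also have "\<dots> = win m ! t"
    proof -
      have "m mod q \<le> length (g (y (m div q)) @ g (y (m div q + 1)))"
        using lt[of m] by (simp add: length_block)
      then show ?thesis unfolding win_def using that by (simp del: drop_append take_append)
    qed
    finally show ?thesis by simp
  qed
  have "n mod q = (n + p) mod q"
  proof (rule synchronizedD[OF check win_mem win_mem])
    show "r \<le> length (win n)" "r \<le> length (win (n + p))" "set (win n) \<subseteq> set A"
      by (simp_all add: len sub)
    show "hd (win n) \<in> set A" if "0 < r"
      using sub[of n] len[of n] that by (cases "win n") auto
    show "win n ! t = win (n + p) ! t" if "t < r" for t
      using rep that by (simp add: nth repeats_def)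
  qed
  then show ?thesis
    by (metis add_diff_cancel_left' le_add1 mod_eq_dvd_iff_nat)
qed

lemma windows3:
  assumes check: "all_all_windows3 P q xss"
    and mem: "g (y (n div q)) @ g (y (n div q + 1)) \<in> set xss" and q: "2 \<le> q"
  shows "P (z n) (z (n + 1)) (z (n + 2))"
proof -
  define xs where "xs = g (y (n div q)) @ g (y (n div q + 1))"
  have lt: "n mod q < q" using pos by simp
  have "z (n + t) = xs ! (n mod q + t)" if "t \<le> 2" for t
  proof -
    have "z (n + t) = z (q * (n div q) + (n mod q + t))" by (simp add: add.assoc [symmetric])
    also have "\<dots> = xs ! (n mod q + t)"
      unfolding xs_def by (intro nth_two_blocks) (use that lt q in linarith)
    finally show ?thesis .
  qed
  from this[of 0] this[of 1] this[of 2] show ?thesis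
    using all_windows3D[OF all_all_windows3D[OF check mem] lt] by (simp add: xs_def)
qed

end

section \<open>A word over six letters without repetitions of exponent 3/2\<close>

definition weights :: "nat list" where
  "weights = [0, 2, 3, 4, 5, 1, 4, 0]"

definition shifted :: "nat \<Rightarrow> nat list" where
  "shifted a = map (\<lambda>d. (a + d) mod 6) weights"

text \<open>The base-8 digits of \<open>n\<close> are weighted and summed modulo 6, so the word is the fixed point of
  the 8-uniform morphism \<open>shifted\<close>.\<close>

fun digit_word :: "nat \<Rightarrow> nat" where
  "digit_word n = (if n = 0 then 0 else (digit_word (n div 8) + weights ! (n mod 8)) mod 6)"

declare digit_word.simps [simp del]

definition pairs :: "(nat \<times> nat) list" where
  "pairs = concat (map (\<lambda>a. map (\<lambda>d. (a, (a + d) mod 6)) [1,2,3]) [0,1,2,3,4,5])"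

text \<open>Six of the nine pairs of steps from 1, 2, 3 suffice: \<open>digit_word_triple\<close>
  shows that every factor of length 3 is listed.\<close>

definition triples :: "(nat \<times> nat \<times> nat) list" where
  "triples = concat (map (\<lambda>a. map (\<lambda>(d, e). (a, (a + d) mod 6, (a + d + e) mod 6))
     [(1,1), (1,2), (2,1), (2,2), (2,3), (3,2)]) [0,1,2,3,4,5])"

definition pair_images :: "(nat \<Rightarrow> nat list) \<Rightarrow> nat list list" where
  "pair_images g = map (\<lambda>(a, b). g a @ g b) pairs"

definition triple_images :: "(nat \<Rightarrow> nat list) \<Rightarrow> nat list list" where
  "triple_images g = map (\<lambda>(a, b, c). g a @ g b @ g c) triples"

lemma pairs_if_triples: "(a, b, c) \<in> set triples \<Longrightarrow> (a, b) \<in> set pairs"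
proof -
  have "list_all (\<lambda>(a, b, c). (a, b) \<in> set pairs) triples" by code_simp
  then show "(a, b, c) \<in> set triples \<Longrightarrow> (a, b) \<in> set pairs" by (auto simp: list_all_iff)
qed

lemma digit_word_less: "digit_word n < 6"
  by (subst digit_word.simps) simp

lemma digit_word_0: "digit_word 0 = 0"
  by (simp add: digit_word.simps[of 0])

lemma length_shifted: "length (shifted a) = 8"
  by (simp add: shifted_def weights_def)

interpretation digits: uniform_image shifted 8 digit_word digit_word
proof
  fix n :: nat
  have lt: "n mod 8 < length weights" by (simp add: weights_def)
  show "digit_word n = shifted (digit_word (n div 8)) ! (n mod 8)"
  proof (cases "n = 0")
    case True
    then show ?thesis by (simp add: digit_word_0 shifted_def weights_def)
  next
    case False
    then show ?thesis using lt by (simp add: digit_word.simps[of n] shifted_def)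
  qed
qed (simp_all add: length_shifted)

definition in_triples :: "nat \<Rightarrow> nat \<Rightarrow> nat \<Rightarrow> bool" where
  "in_triples a b c \<longleftrightarrow> (a, b, c) \<in> set triples"

text \<open>Inside a block the steps are 2, 1, 1, 1, 2, 3, 2. As the first and last weights are 0,
  the step across a border is that of the preimage, with a step 2 on either side.\<close>

lemma check_triples: "all_all_windows3 in_triples 8 (pair_images shifted)"
  by code_simp

text \<open>Three consecutive letters lie in two adjacent blocks, whose preimages form an admissible
  pair by induction at \<open>n div 8\<close>. Position 0 is its own quotient and is computed
  directly.\<close>

lemma digit_word_triple: "(digit_word n, digit_word (n + 1), digit_word (n + 2)) \<in> set triples"
proof (induction n rule: less_induct)
  case (less n)
  show ?case
  proof (cases "n = 0")
    case True
    then show ?thesis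
      using digit_word.simps[of 1] digit_word.simps[of 2]
      by (simp add: digit_word_0 weights_def triples_def numeral_2_eq_2)
  next
    case False
    define m where "m = n div 8"
    have "(digit_word m, digit_word (m + 1), digit_word (m + 2)) \<in> set triples"
      using False by (intro less) (simp add: m_def)
    then have "(digit_word m, digit_word (m + 1)) \<in> set pairs" by (rule pairs_if_triples)
    then have "shifted (digit_word m) @ shifted (digit_word (m + 1)) \<in> set (pair_images shifted)"
      by (force simp: pair_images_def)
    then show ?thesis
      using digits.windows3[OF check_triples, of n] by (simp add: m_def in_triples_def)
  qed
qed

lemma pair_image_mem: "g (digit_word m) @ g (digit_word (m + 1)) \<in> set (pair_images g)"
  using pairs_if_triples[OF digit_word_triple[of m]] by (force simp: pair_images_def)

lemma triple_image_mem:
  "g (digit_word m) @ g (digit_word (m + 1)) @ g (digit_word (m + 2)) \<in> set (triple_images g)"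
  using digit_word_triple[of m] by (force simp: triple_images_def)

text \<open>Periods 1 to 10, each with half its length, rounded up, as overlap. From period 11 on
  the overlap is at least 6, the length of a synchronizing window.\<close>

lemma check_digit_word_short:
  "all_no_repeats 8 [1,1,2,2,3,3,4,4,5,5] 0 (triple_images shifted)"
  by code_simp

lemma check_digit_word_synchronized:
  "synchronized [0,1,2,3,4,5] 6 [0,1,2,3,4,5] (windows 6 8 (pair_images shifted))"
  by code_simp

text \<open>One letter at a known position determines its block, so partially covered blocks at the
  ends also descend.\<close>

lemma shifted_nth_inj:
  assumes "shifted a ! k = shifted b ! k" "k < 8" "a < 6" "b < 6"
  shows "a = b"
proof -
  have "(a + weights ! k) mod 6 = (b + weights ! k) mod 6"
    using assms(1,2) unfolding shifted_def by (subst (asm) (1 2) nth_map) (auto simp: weights_def)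
  then show ?thesis using assms(3,4) by presburger
qed

lemma digit_word_no_repeats:
  assumes "0 < p" "p \<le> 2 * r"
  shows "\<not> repeats digit_word n p r"
  using assms
proof (induction p arbitrary: n r rule: less_induct)
  case (less p)
  show ?case
  proof
    assume rep: "repeats digit_word n p r"
    show False
    proof (cases "p \<le> 10")
      case True
      define rs where "rs = [1,1,2,2,3,3,4,4,5,5::nat]"
      define k where "k = p - 1"
      have k: "k < 10" "p = Suc k" using True less.prems by (auto simp: k_def)
      have "rs = map (\<lambda>k. (k + 2) div 2) [0..<10]" unfolding rs_def by code_simp
      then have rk: "rs ! k = (k + 2) div 2" using k by simp
      have "\<not> repeats digit_word n (Suc (0 + k)) (rs ! k)"
      proof (rule digits.not_repeats)
        show "all_no_repeats 8 rs 0 (triple_images shifted)"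
          unfolding rs_def by (rule check_digit_word_short)
        show "k < length rs" using k by (simp add: rs_def)
        show "0 + k + rs ! k \<le> 2 * 8" using k rk by simp
      qed (rule triple_image_mem)
      moreover have "repeats digit_word n (Suc (0 + k)) (rs ! k)"
        proof (rule repeats_mono)
        show "repeats digit_word n (Suc (0 + k)) r" using rep k(2) by simp
        show "rs ! k \<le> r" using k(2) less.prems(2) unfolding rk by linarith
      qed
      ultimately show False by contradiction
    next
      case False
      have "repeats digit_word n p 6"
        using repeats_mono[OF rep, of 6] False less.prems(2) by linarith
      then have "8 dvd p"
      proof (rule digits.dvd_period[OF check_digit_word_synchronized pair_image_mem, rotated 2])
        show "set (shifted (digit_word m)) \<subseteq> set [0,1,2,3,4,5]" for m
          by (auto simp: shifted_def)
      qed simp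
      then obtain p' where p': "p = 8 * p'" by auto
      \<comment> \<open>\<open>c\<close> and \<open>d\<close> are the first and last blocks that the
        overlap meets.\<close>
      define c where "c = n div 8"
      define d where "d = (n + r - 1) div 8"
      have r: "0 < r" using less.prems by auto
      have c: "8 * c \<le> n" "n < 8 * c + 8" unfolding c_def by linarith+
      have d: "8 * d < n + r" "n + r \<le> 8 * d + 8" unfolding d_def using r by linarith+
      have "repeats digit_word c p' (d - c + 1)"
        unfolding repeats_def
      proof (intro allI impI)
        fix t assume t: "t < d - c + 1"
        define m where "m = c + t"
        \<comment> \<open>The first position of the overlap inside block \<open>m\<close>.\<close>
        define u where "u = max n (8 * m)"
        have cd: "c \<le> d" using c d r by linarith
        have m: "m \<le> d" "c \<le> m" using t cd by (auto simp: m_def)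
        have u: "n \<le> u" "u < n + r" "u div 8 = m"
          using m r c d unfolding u_def by (auto simp: max_def)
        have "digit_word u = digit_word (u + 8 * p')"
          using rep u p' unfolding repeats_def
          by (metis add.assoc add.commute le_Suc_ex nat_add_left_cancel_less)
        then have "shifted (digit_word m) ! (u mod 8) = shifted (digit_word (m + p')) ! (u mod 8)"
          using digits.image[of u] digits.image[of "u + 8 * p'"] u by (simp add: add.commute)
        then have "digit_word m = digit_word (m + p')"
          by (rule shifted_nth_inj) (simp_all add: digit_word_less)
        then show "digit_word (c + t) = digit_word (c + p' + t)"
          by (simp add: m_def add_ac)
      qed
      moreover have "p' < p" "0 < p'" using less.prems p' by auto
      moreover have "p' \<le> 2 * (d - c + 1)"
      proof -
        have "c \<le> d" using c d r by linarith
        then have "r \<le> 8 * (d - c + 1)" using c d by (simp add: diff_mult_distrib2)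
        then show ?thesis using less.prems p' by simp
      qed
      ultimately show False using less.IH by blast
    qed
  qed
qed

section \<open>A ternary word without large repetitions\<close>

text \<open>Found by computer search: factors of length 10 at different positions modulo 25 differ, and the
  longest common prefix and suffix of two distinct blocks have length at most 8 and 3. The descent
  only loses these \<open>8 + 3 < 25 / 2\<close> letters.\<close>

definition blocks :: "nat list list" where
  "blocks =
    [[0,1,1,2,1,0,2,2,0,0,1,2,2,1,1,0,2,0,1,2,1,0,0,2,2],
     [0,1,1,2,2,1,0,1,2,0,0,2,1,1,2,2,0,0,1,2,1,1,0,2,2],
     [0,1,1,2,1,0,2,0,0,1,2,2,1,0,0,2,0,1,2,1,1,0,2,2,0],
     [0,1,1,2,1,0,2,0,1,2,2,1,1,0,0,2,2,0,1,2,1,1,0,2,0],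
     [0,1,1,2,1,0,0,2,0,1,2,2,1,0,1,1,2,0,0,2,2,1,1,0,2],
     [0,1,1,2,1,0,0,2,2,1,1,2,0,0,2,1,0,1,2,2,1,1,0,0,2]]"

definition ternary_word :: "nat \<Rightarrow> nat" where
  "ternary_word n = blocks ! digit_word (n div 25) ! (n mod 25)"

lemma check_blocks: "list_all (\<lambda>b. length b = 25 \<and> set b \<subseteq> {0,1,2}) blocks"
  by (simp add: blocks_def)

lemma block:
  assumes "a < 6"
  shows "length (blocks ! a) = 25" "set (blocks ! a) \<subseteq> {0,1,2}"
proof -
  have "blocks ! a \<in> set blocks" using assms by (intro nth_mem) (simp add: blocks_def)
  then show "length (blocks ! a) = 25" "set (blocks ! a) \<subseteq> {0,1,2}"
    using check_blocks by (auto simp: list_all_iff)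
qed

interpretation ternary: uniform_image "(!) blocks" 25 digit_word ternary_word
  by standard (simp_all add: block digit_word_less ternary_word_def)

lemma ternary_word_range: "ternary_word n \<in> {0,1,2}"
proof -
  have "blocks ! digit_word (n div 25) ! (n mod 25) \<in> set (blocks ! digit_word (n div 25))"
    by (intro nth_mem) (simp add: block digit_word_less)
  then show ?thesis using block(2)[OF digit_word_less] unfolding ternary_word_def by blast
qed

text \<open>The order 1, 0, 2 is dictated by the factors 020, 101 and 121 of the ternary word.\<close>

definition letter_rank :: "nat \<Rightarrow> nat" where
  "letter_rank c = (if c = 1 then 0 else if c = 0 then 1 else 2)"

definition rank_increases :: "nat \<Rightarrow> nat \<Rightarrow> nat \<Rightarrow> bool" where
  "rank_increases a b c \<longleftrightarrow> (a = c \<longrightarrow> letter_rank a < letter_rank b)"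

text \<open>Cubes of letters are excluded as well, since no rank lies below itself.\<close>

lemma check_rank: "all_all_windows3 rank_increases 25 (pair_images ((!) blocks))"
  by code_simp

lemma ternary_word_rank:
  "ternary_word n = ternary_word (n + 2) \<Longrightarrow>
     letter_rank (ternary_word n) < letter_rank (ternary_word (n + 1))"
  using ternary.windows3[OF check_rank pair_image_mem, of n] by (simp add: rank_increases_def)

text \<open>Periods 3 to 18; from 19 on the overlap is at least 10 and synchronization applies.
  Periods 1 and 2 are left out because factors such as 11 and 020 do occur.\<close>

lemma check_ternary_short:
  "all_no_repeats 25 [2,2,3,3,4,4,5,5,6,6,7,7,8,8,9,9] 2 (triple_images ((!) blocks))"
  by code_simp

lemma check_ternary_synchronized:
  "synchronized [0,1,2] 10 [0,1,2] (windows 10 25 (pair_images ((!) blocks)))"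
  by code_simp

text \<open>With \<open>k = 17\<close> and \<open>r = 9\<close> this covers every aligned window of
  9 letters in a block of 25, thus also an overlap that begins and ends inside one block.\<close>

fun no_common :: "nat \<Rightarrow> nat \<Rightarrow> 'a list \<Rightarrow> 'a list \<Rightarrow> bool" where
  "no_common 0 r xs ys = True"
| "no_common (Suc k) r xs ys = (\<not> agree r xs ys \<and> no_common k r (tl xs) (tl ys))"

lemma no_commonD: "no_common k r xs ys \<Longrightarrow> s < k \<Longrightarrow> \<not> agree r (drop s xs) (drop s ys)"
proof (induction k r xs ys arbitrary: s rule: no_common.induct)
  case (2 k r xs ys)
  then show ?case by (cases s) (auto simp: drop_Suc)
qed simp

fun all_separated :: "('a list \<times> 'a list) list \<Rightarrow> bool" where
  "all_separated [] = True"
| "all_separated ((xs, ys) # ps) =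
     (no_common 17 9 xs ys \<and> \<not> agree 4 (drop 21 xs) (drop 21 ys) \<and> all_separated ps)"

lemma all_separatedD:
  "all_separated ps \<Longrightarrow> (xs, ys) \<in> set ps \<Longrightarrow>
     no_common 17 9 xs ys \<and> \<not> agree 4 (drop 21 xs) (drop 21 ys)"
  by (induction ps rule: all_separated.induct) auto

lemma check_separated:
  "all_separated (map (\<lambda>(a, b). (blocks ! a, blocks ! b))
     (filter (\<lambda>(a, b). a \<noteq> b) (List.product [0..<6] [0..<6])))"
  by code_simp

lemma separated:
  assumes "a < 6" "b < 6" "a \<noteq> b"
  shows "no_common 17 9 (blocks ! a) (blocks ! b)"
    "\<not> agree 4 (drop 21 (blocks ! a)) (drop 21 (blocks ! b))"
proof -
  have "(blocks ! a, blocks ! b) \<in> set (map (\<lambda>(a, b). (blocks ! a, blocks ! b))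
     (filter (\<lambda>(a, b). a \<noteq> b) (List.product [0..<6] [0..<6])))"
    using assms by force
  from all_separatedD[OF check_separated this]
  show "no_common 17 9 (blocks ! a) (blocks ! b)"
    "\<not> agree 4 (drop 21 (blocks ! a)) (drop 21 (blocks ! b))" by auto
qed

lemma blocks_eqI:
  assumes "a < 6" "b < 6" and eq: "\<And>k. lo \<le> k \<Longrightarrow> k < hi \<Longrightarrow> blocks ! a ! k = blocks ! b ! k"
    and range: "lo + 9 \<le> hi \<or> lo \<le> 21 \<and> hi = 25" "hi \<le> 25"
  shows "a = b"
proof (rule ccontr)
  assume "a \<noteq> b"
  note sep = separated[OF assms(1,2) this]
  note len = block(1)[OF assms(1)] block(1)[OF assms(2)]
  from range(1) show False
  proof
    assume le: "lo + 9 \<le> hi"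
    have "agree 9 (drop lo (blocks ! a)) (drop lo (blocks ! b))"
      using le range(2) len eq by (intro agreeI) auto
    then show False using no_commonD[OF sep(1), of lo] le range(2) by auto
  next
    assume le: "lo \<le> 21 \<and> hi = 25"
    have "agree 4 (drop 21 (blocks ! a)) (drop 21 (blocks ! b))"
      using le len eq by (intro agreeI) auto
    then show False using sep(2) by contradiction
  qed
qed

lemma ternary_word_no_repeats:
  assumes "3 \<le> p" "p \<le> 2 * r"
  shows "\<not> repeats ternary_word n p r"
proof
  assume rep: "repeats ternary_word n p r"
  show False
  proof (cases "p \<le> 18")
    case True
    define rs where "rs = [2,2,3,3,4,4,5,5,6,6,7,7,8,8,9,9::nat]"
    define k where "k = p - 3"
    have k: "k < 16" "p = Suc (2 + k)" using True assms by (auto simp: k_def)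
    have "rs = map (\<lambda>k. (k + 4) div 2) [0..<16]" unfolding rs_def by code_simp
    then have rk: "rs ! k = (k + 4) div 2" using k by simp
    have "\<not> repeats ternary_word n (Suc (2 + k)) (rs ! k)"
    proof (rule ternary.not_repeats)
      show "all_no_repeats 25 rs 2 (triple_images ((!) blocks))"
        unfolding rs_def by (rule check_ternary_short)
      show "k < length rs" using k by (simp add: rs_def)
      show "2 + k + rs ! k \<le> 2 * 25" using k rk by simp
    qed (rule triple_image_mem)
    moreover have "repeats ternary_word n (Suc (2 + k)) (rs ! k)"
      proof (rule repeats_mono)
      show "repeats ternary_word n (Suc (2 + k)) r" using rep k(2) by simp
      show "rs ! k \<le> r" using k(2) assms(2) unfolding rk by linarith
    qed
    ultimately show False by contradiction
  next
    case False
    have "25 dvd p"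
    proof (rule ternary.dvd_period)
      show "synchronized [0,1,2] 10 [0,1,2] (windows 10 25 (pair_images ((!) blocks)))"
        by (rule check_ternary_synchronized)
      show "set (blocks ! digit_word m) \<subseteq> set [0,1,2]" for m
        using block(2)[OF digit_word_less] by simp
      show "repeats ternary_word n p 10"
        using repeats_mono[OF rep, of 10] False assms(2) by linarith
    qed (simp_all add: pair_image_mem del: One_nat_def)
    then obtain p' where p': "p = 25 * p'" by auto
    have r: "13 \<le> r" using p' assms by presburger
    \<comment> \<open>The blocks \<open>m\<close> with \<open>c \<le> m\<close> and
      \<open>m < d\<close> are those with at least 4 letters from position \<open>n\<close> on and
      at least 9 letters before position \<open>n + r\<close>, as \<open>blocks_eqI\<close>
      requires.\<close>
    define c where "c = (n + 3) div 25"
    define d where "d = (n + r + 16) div 25"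
    have "repeats digit_word c p' (d - c)"
      unfolding repeats_def
    proof (intro allI impI)
      fix t assume t: "t < d - c"
      define m where "m = c + t"
      have m: "c \<le> m" "m < d" using t by (auto simp: m_def)
      have lower: "n + 4 \<le> 25 * m + 25" using m(1) unfolding c_def by linarith
      have upper: "25 * m + 9 \<le> n + r" using m(2) unfolding d_def by linarith
      define lo where "lo = n - 25 * m"
      define hi where "hi = min 25 (n + r - 25 * m)"
      have "digit_word m = digit_word (m + p')"
      proof (rule blocks_eqI[OF digit_word_less digit_word_less, of lo hi])
        fix k assume k: "lo \<le> k" "k < hi"
        have "ternary_word (25 * m + k) = ternary_word (25 * m + k + p)"
        proof -
          have "n \<le> 25 * m + k" using k(1) unfolding lo_def by linarith
          then obtain u where u: "25 * m + k = n + u" by (auto simp: le_iff_add)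
          moreover have "u < r" using k(2) u by (auto simp: hi_def)
          ultimately have "ternary_word (n + u) = ternary_word (n + p + u)"
            using rep by (simp add: repeats_def)
          then show ?thesis unfolding u by (simp add: add_ac)
        qed
        also have "\<dots> = ternary_word (25 * (m + p') + k)" by (simp add: p' algebra_simps)
        finally show "blocks ! digit_word m ! k = blocks ! digit_word (m + p') ! k"
          using k ternary.block_nth[of k m] ternary.block_nth[of k "m + p'"] by (simp add: hi_def)
      next
        show "lo + 9 \<le> hi \<or> lo \<le> 21 \<and> hi = 25" "hi \<le> 25"
          using lower upper r unfolding lo_def hi_def by linarith+
      qed
      then show "digit_word (c + t) = digit_word (c + p' + t)"
        by (simp add: m_def add_ac)
    qed
    moreover have "0 < p'" using p' assms by auto
    moreover have "p' \<le> 2 * (d - c)"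
    proof -
      have "25 * c \<le> n + 3" "n + r + 16 \<le> 25 * d + 24" unfolding c_def d_def by linarith+
      \<comment> \<open>At most 3 letters are lost on the left and 8 on the right. Hence
        \<open>25 * p'\<close> is at most \<open>50 * (d - c) + 22\<close>, and 22 is less than
        25.\<close>
      then have "r \<le> 25 * (d - c) + 11" using r by linarith
      then show ?thesis using assms p' by simp
    qed
    ultimately show False using digit_word_no_repeats by blast
  qed
qed

section \<open>Occurrences as closed walks\<close>

definition edge :: "(nat \<Rightarrow> 'a) \<Rightarrow> 'a list \<Rightarrow> 'a list \<Rightarrow> bool" where
  "edge w u v \<longleftrightarrow> u \<noteq> [] \<and> v \<noteq> [] \<and> factor_of (u @ v @ u) w"

lemma occurrence_T_iff:
  "occurrence \<Sigma> (T i) w h \<longleftrightarrow>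
     (\<forall>x. h x \<in> lists \<Sigma> \<and> h x \<noteq> []) \<and> (\<forall>j<i. edge w (h j) (h ((j + 1) mod i)))"
  by (auto simp: occurrence_def T_def morph_def edge_def)

text \<open>The lexicographic order by length, then rank, as one number: ranks are at most
  2.\<close>

definition weight :: "nat list \<Rightarrow> nat" where
  "weight u = 3 * length u + letter_rank (hd u)"

lemma edge_ternary_word:
  assumes "edge ternary_word u v"
  shows "weight u < weight v"
proof -
  obtain n where n: "u @ v @ u = map ternary_word [n..<n + length (u @ v @ u)]"
    using assms unfolding edge_def factor_of_def by blast
  have ne: "u \<noteq> []" "v \<noteq> []" using assms by (auto simp: edge_def)
  then have len: "0 < length u" "0 < length v" by auto
  define p where "p = length u + length v"
  have nth: "ternary_word (n + k) = (u @ v @ u) ! k" if "k < length (u @ v @ u)" for k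
    using that by (subst n) simp
  have u1: "ternary_word (n + t) = u ! t" if "t < length u" for t
    using nth[of t] that by (simp add: nth_append)
  have u2: "ternary_word (n + p + t) = u ! t" if "t < length u" for t
    using nth[of "p + t"] that by (simp add: nth_append p_def add.assoc)
  have v1: "ternary_word (n + length u) = v ! 0"
    using nth[of "length u"] len by (simp add: nth_append)
  have rep: "repeats ternary_word n p (length u)"
    by (simp add: repeats_def u1 u2)
  have rank: "letter_rank c \<le> 2" for c by (simp add: letter_rank_def)
  show ?thesis
  proof (cases "length u < length v")
    case True
    then show ?thesis using rank[of "hd u"] by (simp add: weight_def)
  next
    case False
    \<comment> \<open>The word \<open>uvu\<close> has period \<open>p\<close> and overlap
      \<open>length u\<close>; if \<open>v\<close> is not longer than \<open>u\<close>, its exponent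
      is at least 3/2.\<close>
    then have "\<not> 3 \<le> p" using rep ternary_word_no_repeats[of p "length u" n] by (auto simp: p_def)
    then have one: "length u = 1" "length v = 1" using len unfolding p_def by linarith+
    have "letter_rank (ternary_word n) < letter_rank (ternary_word (n + 1))"
      using u1[of 0] u2[of 0] one by (intro ternary_word_rank) (simp add: p_def)
    then show ?thesis
      using u1[of 0] v1 one ne by (simp add: weight_def hd_conv_nth)
  qed
qed

text \<open>A variable of maximal weight would have a successor of larger weight.\<close>

lemma ternary_word_avoids_T:
  assumes "0 < i"
  shows "\<not> occurrence \<Sigma> (T i) ternary_word h"
proof
  assume occ: "occurrence \<Sigma> (T i) ternary_word h"
  let ?M = "Max ((\<lambda>j. weight (h j)) ` {..<i})"
  have "?M \<in> (\<lambda>j. weight (h j)) ` {..<i}" using assms by (intro Max_in) auto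
  then obtain j where j: "j < i" "?M = weight (h j)" by auto
  have "weight (h j) < weight (h ((j + 1) mod i))"
    using occ j(1) by (intro edge_ternary_word) (simp add: occurrence_T_iff)
  moreover have "weight (h ((j + 1) mod i)) \<le> ?M"
    using assms by (intro Max_ge) auto
  ultimately show False using j(2) by simp
qed

lemma occurrence_T_if_closed_walks:
  assumes walk2: "edge w u v" "edge w v u"
    and walk3: "edge w u s" "edge w s t" "edge w t u"
    and letters: "{u, v, s, t} \<subseteq> lists \<Sigma>" and i: "2 \<le> i"
  shows "\<exists>h. occurrence \<Sigma> (T i) w h"
proof (cases "even i")
  case True
  define h where "h j = (if even j then u else v)" for j :: nat
  have "edge w (h j) (h ((j + 1) mod i))" if "j < i" for j
  proof (cases "j + 1 = i")
    case True
    then have "odd j" using \<open>even i\<close> by auto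
    then show ?thesis using True walk2 by (simp add: h_def)
  next
    case False
    then show ?thesis using that walk2 by (simp add: h_def)
  qed
  then have "occurrence \<Sigma> (T i) w h"
    using letters walk2 by (auto simp: occurrence_T_iff h_def edge_def)
  then show ?thesis by blast
next
  case False
  \<comment> \<open>The walk of length 3 is traversed once, then the walk of length 2 as often as
    needed; odd positions from 3 on carry \<open>u\<close>.\<close>
  define h where "h j = (if j = 0 then u else if j = 1 then s else if j = 2 then t
    else if odd j then u else v)" for j :: nat
  have "edge w (h j) (h ((j + 1) mod i))" if "j < i" for j
  proof (cases "j + 1 = i")
    case True
    then have "even j" "j \<noteq> 0" using \<open>odd i\<close> i by auto
    then show ?thesis using True walk2 walk3 by (auto simp: h_def)
  next
    case False
    then have "(j + 1) mod i = j + 1" using that by simp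
    moreover have "edge w (h j) (h (j + 1))"
    proof -
      consider "j = 0" | "j = 1" | "j = 2" | "3 \<le> j" by linarith
      then show ?thesis using walk2 walk3 by cases (auto simp: h_def)
    qed
    ultimately show ?thesis by simp
  qed
  then have "occurrence \<Sigma> (T i) w h"
    using letters walk2 walk3 by (auto simp: occurrence_T_iff h_def edge_def)
  then show ?thesis by blast
qed

section \<open>Binary words\<close>

fun contains_all :: "'a list list \<Rightarrow> 'a list \<Rightarrow> bool" where
  "contains_all [] w = True"
| "contains_all (x # xs) w = (if sublist x w then contains_all xs w else False)"

lemma contains_all_iff: "contains_all xs w \<longleftrightarrow> (\<forall>x\<in>set xs. sublist x w)"
  by (induction xs) auto

fun contains_some :: "'a list list list \<Rightarrow> 'a list \<Rightarrow> bool" where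
  "contains_some [] w = False"
| "contains_some (c # cs) w = (if contains_all c w then True else contains_some cs w)"

lemma contains_some_iff: "contains_some cs w \<longleftrightarrow> (\<exists>c\<in>set cs. \<forall>x\<in>set c. sublist x w)"
  by (induction cs) (auto simp: contains_all_iff)

fun unavoidable :: "nat list list list \<Rightarrow> nat \<Rightarrow> nat list \<Rightarrow> bool" where
  "unavoidable cs 0 w = contains_some cs w"
| "unavoidable cs (Suc d) w = (if contains_some cs w then True
     else unavoidable cs d (0 # w) \<and> unavoidable cs d (1 # w))"

text \<open>The search extends words on the left, so the last letter of \<open>v\<close> is added
  first. A branch may stop early because factors persist in extensions.\<close>

lemma unavoidableD:
  "unavoidable cs d w \<Longrightarrow> length v = d \<Longrightarrow> set v \<subseteq> {0, 1} \<Longrightarrow> contains_some cs (v @ w)"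
proof (induction cs d w arbitrary: v rule: unavoidable.induct)
  case (2 cs d w)
  show ?case
  proof (cases "contains_some cs w")
    case True
    then show ?thesis 
      unfolding contains_some_iff by (meson sublist_append_leftI sublist_order.order_trans)
  next
    case False
    obtain v' b where v: "v = v' @ [b]" using "2.prems"(2) by (cases v rule: rev_cases) auto
    have "contains_some cs (v' @ b # w)"
      using "2.IH"[of v'] "2.prems" False by (auto simp: v)
    then show ?thesis by (simp add: v)
  qed
qed simp

text \<open>A quadruple \<open>(u, v, s, t)\<close> stands for the closed walks \<open>u \<rightarrow> v \<rightarrow> u\<close> and \<open>u \<rightarrow> s \<rightarrow> t \<rightarrow> u\<close>. The list was
  found by computer search.\<close>

definition walks :: "(nat list \<times> nat list \<times> nat list \<times> nat list) list" where
  "walks = map (\<lambda>u. (u, u, u, u))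
     [[0], [1], [0,1], [1,0], [0,1,0], [1,0,1], [0,1,1,0], [1,0,1,1,0], [0,1,0,0,1]] @
   [([0], [1], [1,0], [1]), ([0], [1], [0,1], [1,0]), ([0], [1], [1,0], [0,1]),
    ([1], [1,0], [0,1], [1,0]), ([0], [1,0], [0,1], [1,0])]"

definition walk_factors :: "'a list \<times> 'a list \<times> 'a list \<times> 'a list \<Rightarrow> 'a list list" where
  "walk_factors = (\<lambda>(u, v, s, t). [u @ v @ u, v @ u @ v, u @ s @ u, s @ t @ s, t @ u @ t])"

lemma check_unavoidable: "unavoidable (map walk_factors walks) 22 []"
  by code_simp

text \<open>Carries a factor found in a coded finite prefix back to the original alphabet.\<close>

lemma factor_of_map:
  assumes "sublist x (map b [0..<m])"
  shows "factor_of (map f x) (\<lambda>n. f (b n))"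
proof -
  obtain ps ss where eq: "map b [0..<m] = ps @ x @ ss" using assms by (auto simp: sublist_def)
  define k where "k = length ps"
  have "length ps + length x + length ss = m" using arg_cong[OF eq, of length] by simp
  then have m: "k + length x \<le> m" by (simp add: k_def)
  have "x ! t = b (k + t)" if "t < length x" for t
  proof -
    have "x ! t = map b [0..<m] ! (k + t)"
      using that by (subst eq) (simp add: k_def nth_append)
    then show ?thesis using that m by simp
  qed
  then have "map f x = map (\<lambda>n. f (b n)) [k..<k + length x]"
    by (intro nth_equalityI) auto
  then show ?thesis unfolding factor_of_def by (intro exI[of _ k]) simp
qed

lemma binary_word_contains_T:
  assumes w: "infinite_word_over {a, b} w" and i: "2 \<le> i"
  shows "\<exists>h. occurrence {a, b} (T i) w h"
proof -
  \<comment> \<open>The case \<open>a = b\<close> is allowed: every code is then 0, which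
    \<open>f\<close> decodes to \<open>a\<close>.\<close>
  define code where "code n = (if w n = a then 0 else 1 :: nat)" for n
  define f where "f c = (if c = (0 :: nat) then a else b)" for c
  have "w n = f (code n)" for n
  proof -
    have "w n \<in> {a, b}" using w by (auto simp: infinite_word_over_def)
    then show ?thesis by (auto simp: f_def code_def)
  qed
  then have w_eq: "w = (\<lambda>n. f (code n))" by auto
  have "contains_some (map walk_factors walks) (map code [0..<22] @ [])"
    by (rule unavoidableD[OF check_unavoidable]) (auto simp: code_def)
  then obtain u v s t where mem: "(u, v, s, t) \<in> set walks"
    and sub: "\<And>x. x \<in> set (walk_factors (u, v, s, t)) \<Longrightarrow> sublist x (map code [0..<22])"
    by (fastforce simp: contains_some_iff)
  have ne: "u \<noteq> []" "v \<noteq> []" "s \<noteq> []" "t \<noteq> []"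
    using mem by (auto simp: walks_def)
  have fac: "factor_of (map f x) w" if "x \<in> set (walk_factors (u, v, s, t))" for x
    unfolding w_eq using sub[OF that] by (rule factor_of_map)
  have lists: "map f x \<in> lists {a, b}" for x by (auto simp: f_def)
  show ?thesis
  proof (rule occurrence_T_if_closed_walks[where u = "map f u" and v = "map f v"
        and s = "map f s" and t = "map f t"])
    show "edge w (map f u) (map f v)" "edge w (map f v) (map f u)" "edge w (map f u) (map f s)"
      "edge w (map f s) (map f t)" "edge w (map f t) (map f u)"
      using fac[of "u @ v @ u"] fac[of "v @ u @ v"] fac[of "u @ s @ u"] fac[of "s @ t @ s"]
        fac[of "t @ u @ t"] ne
      by (simp_all add: edge_def walk_factors_def)
    show "{map f u, map f v, map f s, map f t} \<subseteq> lists {a, b}" using lists by blast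
  qed (rule i)
qed

section \<open>The avoidability index\<close>

lemma three_le_card_if_avoidable:
  assumes "avoidable_over \<Sigma> (T i)" "finite \<Sigma>" "2 \<le> i"
  shows "3 \<le> card \<Sigma>"
proof (rule ccontr)
  assume "\<not> 3 \<le> card \<Sigma>"
  obtain w where w: "infinite_word_over \<Sigma> w" "\<nexists>h. occurrence \<Sigma> (T i) w h"
    using assms(1) by (auto simp: avoidable_over_def)
  have "\<Sigma> \<noteq> {}" using w(1) by (auto simp: infinite_word_over_def)
  then have "card \<Sigma> = 1 \<or> card \<Sigma> = 2"
    using \<open>\<not> 3 \<le> card \<Sigma>\<close> assms(2) card_gt_0_iff[of \<Sigma>] by linarith
  \<comment> \<open>A singleton is read as \<open>{a, a}\<close>, so alphabets of sizes 1 and 2 are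
    treated together.\<close>
  then obtain a b where "\<Sigma> = {a, b}"
    by (metis card_1_singletonE card_2_iff insert_absorb2)
  then show False using binary_word_contains_T[of a b w i] assms(3) w by simp
qed

theorem theorem12:
  fixes i :: nat
  assumes "i \<ge> 2"
  shows "avoidability_index (T i) = 3"
proof -
  let ?C = "{enat (card \<Sigma>) | \<Sigma> :: nat set. finite \<Sigma> \<and> avoidable_over \<Sigma> (T i)}"
  have "infinite_word_over {0,1,2} ternary_word"
    unfolding infinite_word_over_def image_subset_iff using ternary_word_range by blast
  moreover have "\<nexists>h. occurrence {0,1,2} (T i) ternary_word h"
    using ternary_word_avoids_T[of i] assms by simp
  ultimately have "avoidable_over {0,1,2 :: nat} (T i)"
    unfolding avoidable_over_def by blast
  moreover have "card {0,1,2 :: nat} = 3" by simp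
  ultimately have "enat 3 \<in> ?C" by (intro CollectI exI[of _ "{0,1,2}"]) auto
  then have "Inf ?C \<le> enat 3" by (rule Inf_lower)
  moreover have "enat 3 \<le> Inf ?C"
    using three_le_card_if_avoidable assms by (intro Inf_greatest) auto
  ultimately show ?thesis
    by (simp add: avoidability_index_def numeral_eq_enat)
qed

end
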